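(* For $n=2$ there is exactly one joint-groups Sudoku (of size $4$ by $4$) up to relabeling the digits, namely the one with rows $1234$, $4321$, $3412$, $2143$. In particular, all joint-groups Sudokus for $n=2$ are box-cyclic.
   Context: A complete $n^2$ by $n^2$ Sudoku is an $n^2$ by $n^2$ grid, divided into $n^2$ non-overlapping $n$ by $n$ boxes in the standard way (each box is the intersection of one of $n$ horizontal bands and one of $n$ vertical stacks), filled with the digits $1,\dots,n^2$ so that every row, column and box contains each digit exactly once. Positions inside a box are given by coordinates $(r,c)$ (row from the top, column from the left). A joint-groups Sudoku is a complete Sudoku in which for each digit there is a function $f:\{1,\dots,n\}\to\{1,\dots,n\}$ (depending on the digit) such that in every box the digit occupies a position of the form $(i,f(i))$. A complete Sudoku is box-cyclic if the boxes in every band are those of the band above cycled one box to the right, that is, the box at the intersection of band $i$ and stack $j$ is identical to the box at the intersection of band $i+k$ and stack $j+k$ for all $i,j,k$, where band and stack numbers are taken modulo $n$. *)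

theory Defs
  imports Main "HOL-Number_Theory.Cong" "HOL-Library.FuncSet"
begin

text \<open>
  A grid is a function from row and column numbers to digits. Rows, columns, bands, stacks,
  digits and positions inside a box are all numbered from 1. Only the values at rows and
  columns in \<open>{1..n^2}\<close> belong to the grid; every notion below looks at these values only.
\<close>

type_synonym grid = "nat \<Rightarrow> nat \<Rightarrow> nat"

text \<open>\<open>box_entry n S i j r c\<close> is the entry at position \<open>(r, c)\<close> of the box at the
  intersection of band \<open>i\<close> and stack \<open>j\<close>.\<close>

definition box_entry :: "nat \<Rightarrow> grid \<Rightarrow> nat \<Rightarrow> nat \<Rightarrow> nat \<Rightarrow> nat \<Rightarrow> nat" where
  "box_entry n S i j r c = S ((i - 1) * n + r) ((j - 1) * n + c)"

definition complete_sudoku :: "nat \<Rightarrow> grid \<Rightarrow> bool" where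
  "complete_sudoku n S \<longleftrightarrow>
     (\<forall>r\<in>{1..n^2}. bij_betw (\<lambda>c. S r c) {1..n^2} {1..n^2}) \<and>
     (\<forall>c\<in>{1..n^2}. bij_betw (\<lambda>r. S r c) {1..n^2} {1..n^2}) \<and>
     (\<forall>i\<in>{1..n}. \<forall>j\<in>{1..n}.
        bij_betw (\<lambda>(r, c). box_entry n S i j r c) ({1..n} \<times> {1..n}) {1..n^2})"

definition joint_groups_sudoku :: "nat \<Rightarrow> grid \<Rightarrow> bool" where
  "joint_groups_sudoku n S \<longleftrightarrow>
     complete_sudoku n S \<and>
     (\<forall>d\<in>{1..n^2}. \<exists>f\<in>{1..n} \<rightarrow> {1..n}.
        \<forall>i\<in>{1..n}. \<forall>j\<in>{1..n}. \<exists>r\<in>{1..n}. box_entry n S i j r (f r) = d)"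

definition box_cyclic :: "nat \<Rightarrow> grid \<Rightarrow> bool" where
  "box_cyclic n S \<longleftrightarrow>
     complete_sudoku n S \<and>
     (\<forall>i\<in>{1..n}. \<forall>j\<in>{1..n}. \<forall>i'\<in>{1..n}. \<forall>j'\<in>{1..n}. \<forall>k.
        [i' = i + k] (mod n) \<longrightarrow> [j' = j + k] (mod n) \<longrightarrow>
        (\<forall>r\<in>{1..n}. \<forall>c\<in>{1..n}. box_entry n S i' j' r c = box_entry n S i j r c))"

definition relabeling_of :: "nat \<Rightarrow> grid \<Rightarrow> grid \<Rightarrow> bool" where
  "relabeling_of n S T \<longleftrightarrow>
     (\<exists>p. bij_betw p {1..n^2} {1..n^2} \<and> (\<forall>r\<in>{1..n^2}. \<forall>c\<in>{1..n^2}. S r c = p (T r c)))"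

definition grid_of_rows :: "nat list list \<Rightarrow> grid" where
  "grid_of_rows rows r c = rows ! (r - 1) ! (c - 1)"

end

theory Submission imports Defs begin

text \<open>
  The heart of the matter is a fact about joint-groups Sudokus of every size: the function \<open>f\<close>
  attached to a digit is a permutation. Going down a stack, the digit meets a new column in each
  of the \<open>n\<close> boxes, and all these columns are values of \<open>f\<close>, so \<open>f\<close> is onto
  (\<open>joint_groups_inj\<close>). Consequently, in two boxes of one band or one stack, a digit changes its
  row inside the box if and only if it changes its column. The Sudoku conditions force one of
  the two changes, so both happen (\<open>same_band_moves\<close>, \<open>same_stack_moves\<close>).

  For \<open>n = 2\<close>, changing both coordinates in a box means moving to the opposite corner. Hence
  passing to a neighbouring box rotates the box by a half turn: the upper left box determines the
  whole grid, and diagonally opposite boxes coincide. The first box can be filled arbitrarily up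
  to relabeling, which gives uniqueness; the coincidence of diagonal boxes is box-cyclicity.
\<close>

section \<open>Lines of the grid\<close>

lemma line_mem:
  fixes n j c :: nat
  assumes "j \<in> {1..n}" "c \<in> {1..n}"
  shows "(j - 1) * n + c \<in> {1..n^2}"
proof -
  have "(j - 1) * n + c \<le> (j - 1) * n + n" using assms by simp
  also have "\<dots> = j * n" using assms by (cases j) auto
  also have "\<dots> \<le> n^2" using assms by (simp add: power2_eq_square)
  finally show ?thesis using assms by simp
qed

lemma line_eqD:
  fixes n j c j' c' :: nat
  assumes "j \<in> {1..n}" "c \<in> {1..n}" "j' \<in> {1..n}" "c' \<in> {1..n}"
    and eq: "(j - 1) * n + c = (j' - 1) * n + c'"
  shows "j = j' \<and> c = c'"
proof -
  have block: "((k - 1) * n + b - 1) div n = k - 1" if "b \<in> {1..n}" for k b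
  proof -
    have "n \<noteq> 0" using that by auto
    have "(k - 1) * n + b - 1 = (b - 1) + (k - 1) * n" using that by simp
    also have "\<dots> div n = (k - 1) + (b - 1) div n" by (rule div_mult_self1[OF \<open>n \<noteq> 0\<close>])
    also have "(b - 1) div n = 0" using that by (intro div_less) auto
    finally show ?thesis by simp
  qed
  have "j - 1 = j' - 1" using block[of c j] block[of c' j'] assms by simp
  with assms show ?thesis by auto
qed

lemma row_entry_inj:
  assumes "complete_sudoku n S"
    and "i \<in> {1..n}" "r \<in> {1..n}" "j \<in> {1..n}" "c \<in> {1..n}" "j' \<in> {1..n}" "c' \<in> {1..n}"
    and "box_entry n S i j r c = box_entry n S i j' r c'"
  shows "j = j'"
proof -
  have "inj_on (\<lambda>c. S ((i - 1) * n + r) c) {1..n^2}"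
    using assms line_mem[of i n r] unfolding complete_sudoku_def bij_betw_def by blast
  then have "(j - 1) * n + c = (j' - 1) * n + c'"
    using assms(8) line_mem[OF assms(4,5)] line_mem[OF assms(6,7)]
    unfolding box_entry_def inj_on_def by blast
  then show ?thesis using line_eqD assms by blast
qed

lemma column_entry_inj:
  assumes "complete_sudoku n S"
    and "j \<in> {1..n}" "c \<in> {1..n}" "i \<in> {1..n}" "r \<in> {1..n}" "i' \<in> {1..n}" "r' \<in> {1..n}"
    and "box_entry n S i j r c = box_entry n S i' j r' c"
  shows "i = i'"
proof -
  have "inj_on (\<lambda>r. S r ((j - 1) * n + c)) {1..n^2}"
    using assms line_mem[of j n c] unfolding complete_sudoku_def bij_betw_def by blast
  then have "(i - 1) * n + r = (i' - 1) * n + r'"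
    using assms(8) line_mem[OF assms(4,5)] line_mem[OF assms(6,7)]
    unfolding box_entry_def inj_on_def by blast
  then show ?thesis using line_eqD assms by blast
qed

lemma box_entry_inj:
  assumes "complete_sudoku n S" "i \<in> {1..n}" "j \<in> {1..n}"
    and "r \<in> {1..n}" "c \<in> {1..n}" "r' \<in> {1..n}" "c' \<in> {1..n}"
    and "box_entry n S i j r c = box_entry n S i j r' c'"
  shows "r = r' \<and> c = c'"
proof -
  have "inj_on (\<lambda>(r, c). box_entry n S i j r c) ({1..n} \<times> {1..n})"
    using assms unfolding complete_sudoku_def bij_betw_def by blast
  from inj_onD[OF this, of "(r, c)" "(r', c')"] show ?thesis using assms by simp
qed

lemma box_entry_mem:
  assumes "complete_sudoku n S" "i \<in> {1..n}" "j \<in> {1..n}" "r \<in> {1..n}" "c \<in> {1..n}"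
  shows "box_entry n S i j r c \<in> {1..n^2}"
proof -
  have "bij_betw (\<lambda>(r, c). box_entry n S i j r c) ({1..n} \<times> {1..n}) {1..n^2}"
    using assms unfolding complete_sudoku_def by blast
  from bij_betw_apply[OF this, of "(r, c)"] show ?thesis using assms by simp
qed

section \<open>Digits of a joint-groups Sudoku\<close>

text \<open>The digit occupies distinct columns in the \<open>n\<close> boxes of the first stack, and all these
  columns are values of \<open>f\<close>. Hence \<open>f\<close> maps \<open>{1..n}\<close> onto itself, and by finiteness it is
  injective.\<close>

lemma joint_groups_inj:
  assumes sudoku: "complete_sudoku n S" and f: "f \<in> {1..n} \<rightarrow> {1..n}"
    and d: "\<forall>i\<in>{1..n}. \<forall>j\<in>{1..n}. \<exists>r\<in>{1..n}. box_entry n S i j r (f r) = d"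
  shows "inj_on f {1..n}"
proof (cases "n = 0")
  case False
  then have one: "1 \<in> {1..n}" by simp
  have "\<exists>\<rho>. \<forall>i\<in>{1..n}. \<rho> i \<in> {1..n} \<and> box_entry n S i 1 (\<rho> i) (f (\<rho> i)) = d"
    using d one by (intro bchoice) blast
  then obtain \<rho> where \<rho>: "\<And>i. i \<in> {1..n} \<Longrightarrow> \<rho> i \<in> {1..n}"
    "\<And>i. i \<in> {1..n} \<Longrightarrow> box_entry n S i 1 (\<rho> i) (f (\<rho> i)) = d"
    by blast
  have "inj_on (\<lambda>i. f (\<rho> i)) {1..n}"
  proof (rule inj_onI)
    fix i i' assume i: "i \<in> {1..n}" "i' \<in> {1..n}" and eq: "f (\<rho> i) = f (\<rho> i')"
    have "box_entry n S i 1 (\<rho> i) (f (\<rho> i)) = box_entry n S i' 1 (\<rho> i') (f (\<rho> i))"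
      using \<rho>(2)[OF i(1)] \<rho>(2)[OF i(2)] eq by simp
    then show "i = i'"
      using column_entry_inj[OF sudoku one _ i(1) \<rho>(1)[OF i(1)] i(2) \<rho>(1)[OF i(2)]]
        f \<rho>(1)[OF i(1)] by blast
  qed
  moreover have "(\<lambda>i. f (\<rho> i)) ` {1..n} \<subseteq> {1..n}" using f \<rho>(1) by blast
  ultimately have "(\<lambda>i. f (\<rho> i)) ` {1..n} = {1..n}" by (intro endo_inj_surj) auto
  then have "{1..n} \<subseteq> f ` {1..n}" using \<rho>(1) by blast
  then have "f ` {1..n} = {1..n}" using f by blast
  then show ?thesis by (intro eq_card_imp_inj_on) auto
qed simp

lemma digit_function:
  assumes "joint_groups_sudoku n S" "d \<in> {1..n^2}"
  obtains f where "f \<in> {1..n} \<rightarrow> {1..n}" "inj_on f {1..n}"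
    "\<And>i j. i \<in> {1..n} \<Longrightarrow> j \<in> {1..n} \<Longrightarrow> \<exists>r\<in>{1..n}. box_entry n S i j r (f r) = d"
proof -
  obtain f where f: "f \<in> {1..n} \<rightarrow> {1..n}"
    "\<forall>i\<in>{1..n}. \<forall>j\<in>{1..n}. \<exists>r\<in>{1..n}. box_entry n S i j r (f r) = d"
    using assms unfolding joint_groups_sudoku_def by blast
  moreover have "inj_on f {1..n}"
    using joint_groups_inj[OF _ f] assms unfolding joint_groups_sudoku_def by blast
  ultimately show thesis using that by blast
qed

text \<open>Both positions lie on the graph of the same injective function, so agreement in one
  coordinate implies agreement in the other.\<close>

lemma joint_groups_row_iff_column:
  assumes joint: "joint_groups_sudoku n S"
    and box: "i \<in> {1..n}" "j \<in> {1..n}" and rc: "r \<in> {1..n}" "c \<in> {1..n}"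
    and box': "i' \<in> {1..n}" "j' \<in> {1..n}" and rc': "r' \<in> {1..n}" "c' \<in> {1..n}"
    and eq: "box_entry n S i j r c = box_entry n S i' j' r' c'"
  shows "r = r' \<longleftrightarrow> c = c'"
proof -
  have sudoku: "complete_sudoku n S" using joint unfolding joint_groups_sudoku_def by blast
  obtain f where f: "f \<in> {1..n} \<rightarrow> {1..n}" "inj_on f {1..n}"
    "\<And>a b. a \<in> {1..n} \<Longrightarrow> b \<in> {1..n} \<Longrightarrow>
      \<exists>q\<in>{1..n}. box_entry n S a b q (f q) = box_entry n S i j r c"
    using digit_function[OF joint box_entry_mem[OF sudoku box rc]] by blast
  have on_graph: "b = f a"
    if pos: "k \<in> {1..n}" "l \<in> {1..n}" "a \<in> {1..n}" "b \<in> {1..n}"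
      and val: "box_entry n S k l a b = box_entry n S i j r c" for k l a b
  proof -
    obtain q where q: "q \<in> {1..n}" "box_entry n S k l q (f q) = box_entry n S k l a b"
      using f(3)[OF pos(1,2)] val by auto
    then have "f q \<in> {1..n}" using f(1) by blast
    then show ?thesis using box_entry_inj[OF sudoku pos(1,2) q(1) _ pos(3,4) q(2)] by blast
  qed
  have "c = f r" "c' = f r'"
    using on_graph[OF box rc] on_graph[OF box' rc'] eq by simp_all
  then show ?thesis using f(2) rc rc' by (auto dest: inj_onD)
qed

lemma same_band_moves:
  assumes joint: "joint_groups_sudoku n S"
    and pos: "i \<in> {1..n}" "j \<in> {1..n}" "r \<in> {1..n}" "c \<in> {1..n}"
      "j' \<in> {1..n}" "r' \<in> {1..n}" "c' \<in> {1..n}"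
    and ne: "j \<noteq> j'" and eq: "box_entry n S i j r c = box_entry n S i j' r' c'"
  shows "r \<noteq> r' \<and> c \<noteq> c'"
proof -
  have "complete_sudoku n S" using joint unfolding joint_groups_sudoku_def by blast
  then have "r \<noteq> r'" using row_entry_inj[of n S i r j c j' c'] pos ne eq by blast
  then show ?thesis
    using joint_groups_row_iff_column[OF joint pos(1-4) pos(1) pos(5-7) eq] by blast
qed

lemma same_stack_moves:
  assumes joint: "joint_groups_sudoku n S"
    and pos: "i \<in> {1..n}" "j \<in> {1..n}" "r \<in> {1..n}" "c \<in> {1..n}"
      "i' \<in> {1..n}" "r' \<in> {1..n}" "c' \<in> {1..n}"
    and ne: "i \<noteq> i'" and eq: "box_entry n S i j r c = box_entry n S i' j r' c'"
  shows "r \<noteq> r' \<and> c \<noteq> c'"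
proof -
  have "complete_sudoku n S" using joint unfolding joint_groups_sudoku_def by blast
  then have "c \<noteq> c'" using column_entry_inj[of n S j c i r i' r'] pos ne eq by blast
  then show ?thesis
    using joint_groups_row_iff_column[OF joint pos(1-4) pos(5) pos(2) pos(6,7) eq] by blast
qed

text \<open>Every digit of a box also occurs in any other box, which turns the preceding statements
  about two occurrences of a digit into a description of the other box.\<close>

lemma entry_in_other_box:
  assumes "complete_sudoku n S" "i \<in> {1..n}" "j \<in> {1..n}" "r \<in> {1..n}" "c \<in> {1..n}"
    "i' \<in> {1..n}" "j' \<in> {1..n}"
  obtains r' c' where "r' \<in> {1..n}" "c' \<in> {1..n}"
    "box_entry n S i j r c = box_entry n S i' j' r' c'"
proof -
  have "bij_betw (\<lambda>(r, c). box_entry n S i' j' r c) ({1..n} \<times> {1..n}) {1..n^2}"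
    using assms unfolding complete_sudoku_def by blast
  then have "box_entry n S i j r c \<in> (\<lambda>(r, c). box_entry n S i' j' r c) ` ({1..n} \<times> {1..n})"
    using box_entry_mem[OF assms(1-5)] unfolding bij_betw_def by simp
  then show thesis using that by auto
qed

section \<open>Two by two boxes\<close>

lemma other_of_two:
  fixes x y :: nat
  assumes "x \<in> {1..2}" "y \<in> {1..2}" "x \<noteq> y"
  shows "y = 3 - x"
  using assms by auto

lemma same_band_half_turn:
  assumes joint: "joint_groups_sudoku 2 S"
    and pos: "i \<in> {1..2}" "j \<in> {1..2}" "j' \<in> {1..2}" "r \<in> {1..2}" "c \<in> {1..2}" and ne: "j \<noteq> j'"
  shows "box_entry 2 S i j' (3 - r) (3 - c) = box_entry 2 S i j r c"
proof -
  have "complete_sudoku 2 S" using joint unfolding joint_groups_sudoku_def by blast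
  from entry_in_other_box[OF this pos(1,2,4,5) pos(1,3)] obtain r' c' where
    rc': "r' \<in> {1..2}" "c' \<in> {1..2}" "box_entry 2 S i j r c = box_entry 2 S i j' r' c'" .
  have "r \<noteq> r' \<and> c \<noteq> c'"
    using same_band_moves[OF joint pos(1,2,4,5,3) rc'(1,2) ne rc'(3)] .
  then have "r' = 3 - r" "c' = 3 - c"
    using other_of_two[OF pos(4) rc'(1)] other_of_two[OF pos(5) rc'(2)] by blast+
  with rc'(3) show ?thesis by simp
qed

lemma same_stack_half_turn:
  assumes joint: "joint_groups_sudoku 2 S"
    and pos: "i \<in> {1..2}" "j \<in> {1..2}" "i' \<in> {1..2}" "r \<in> {1..2}" "c \<in> {1..2}" and ne: "i \<noteq> i'"
  shows "box_entry 2 S i' j (3 - r) (3 - c) = box_entry 2 S i j r c"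
proof -
  have "complete_sudoku 2 S" using joint unfolding joint_groups_sudoku_def by blast
  from entry_in_other_box[OF this pos(1,2,4,5) pos(3,2)] obtain r' c' where
    rc': "r' \<in> {1..2}" "c' \<in> {1..2}" "box_entry 2 S i j r c = box_entry 2 S i' j r' c'" .
  have "r \<noteq> r' \<and> c \<noteq> c'"
    using same_stack_moves[OF joint pos(1,2,4,5,3) rc'(1,2) ne rc'(3)] .
  then have "r' = 3 - r" "c' = 3 - c"
    using other_of_two[OF pos(4) rc'(1)] other_of_two[OF pos(5) rc'(2)] by blast+
  with rc'(3) show ?thesis by simp
qed

text \<open>One step right and one step down amount to two half turns, which cancel.\<close>

lemma diagonal_boxes_equal:
  assumes joint: "joint_groups_sudoku 2 S"
    and pos: "i \<in> {1..2}" "j \<in> {1..2}" "i' \<in> {1..2}" "j' \<in> {1..2}" "r \<in> {1..2}" "c \<in> {1..2}"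
    and ne: "i \<noteq> i'" "j \<noteq> j'"
  shows "box_entry 2 S i' j' r c = box_entry 2 S i j r c"
proof -
  have "3 - r \<in> {1..2}" "3 - c \<in> {1..2}" "3 - (3 - r) = r" "3 - (3 - c) = c" using pos by auto
  then have "box_entry 2 S i' j' r c = box_entry 2 S i j' (3 - r) (3 - c)"
    using same_stack_half_turn[OF joint pos(1,4,3), of "3 - r" "3 - c"] ne by simp
  also have "\<dots> = box_entry 2 S i j r c"
    using same_band_half_turn[OF joint pos(1,2,4,5,6) ne(2)] .
  finally show ?thesis .
qed

lemma joint_groups_2_box_cyclic:
  assumes joint: "joint_groups_sudoku 2 S"
  shows "box_cyclic 2 S"
  unfolding box_cyclic_def
proof (intro conjI ballI allI impI)
  show "complete_sudoku 2 S" using joint unfolding joint_groups_sudoku_def by blast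
next
  fix i j i' j' k r c :: nat
  assume pos: "i \<in> {1..2}" "j \<in> {1..2}" "i' \<in> {1..2}" "j' \<in> {1..2}" "r \<in> {1..2}" "c \<in> {1..2}"
    and i': "[i' = i + k] (mod 2)" and j': "[j' = j + k] (mod 2)"
  have two: "x = 1 \<or> x = 2" if "x \<in> {1..2}" for x :: nat using that by auto
  have "i' = i \<longleftrightarrow> j' = j"
    using i' j' two[OF pos(1)] two[OF pos(2)] two[OF pos(3)] two[OF pos(4)]
    unfolding cong_def by presburger
  then show "box_entry 2 S i' j' r c = box_entry 2 S i j r c"
    using diagonal_boxes_equal[OF joint pos] by (cases "i = i'") auto
qed

section \<open>The unique grid\<close>

abbreviation base_grid :: grid where
  "base_grid \<equiv> grid_of_rows [[1, 2, 3, 4], [4, 3, 2, 1], [3, 4, 1, 2], [2, 1, 4, 3]]"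

lemma set_1_2: "{1..2} = {1, 2::nat}"
  by auto

lemma set_1_4: "{1..2^2} = {1, 2, 3, 4::nat}"
  by auto

lemma base_grid_joint_groups: "joint_groups_sudoku 2 base_grid"
proof -
  have "complete_sudoku 2 base_grid"
    unfolding complete_sudoku_def set_1_2 set_1_4
    by (simp add: bij_betw_def inj_on_def box_entry_def grid_of_rows_def insert_commute)
  moreover have "\<exists>f\<in>{1..2} \<rightarrow> {1..2}. \<forall>i\<in>{1..2}. \<forall>j\<in>{1..2}. \<exists>r\<in>{1..2}.
      box_entry 2 base_grid i j r (f r) = d"
    if "d \<in> {1..2^2}" for d
    \<comment> \<open>The odd digits occupy the main diagonals of the boxes, the even ones the antidiagonals.\<close>
    using that unfolding set_1_2 set_1_4
    by (intro bexI[of _ "\<lambda>r. if odd d then r else 3 - r"])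
      (auto simp: box_entry_def grid_of_rows_def)
  ultimately show ?thesis unfolding joint_groups_sudoku_def by blast
qed

text \<open>The first row of the base grid is the identity, so the relabeling can only be the first row
  of \<open>S\<close>. Half turns express the upper right and lower left box through the upper left one, and the
  lower right box equals the upper left one; this expresses all sixteen entries by the four
  entries of the first row.\<close>

lemma joint_groups_2_relabeling:
  assumes joint: "joint_groups_sudoku 2 S"
  shows "relabeling_of 2 S base_grid"
proof -
  have "complete_sudoku 2 S" using joint unfolding joint_groups_sudoku_def by blast
  then have row: "bij_betw (S 1) {1..2^2} {1..2^2}" unfolding complete_sudoku_def by simp
  have band: "box_entry 2 S 1 2 (3 - r) (3 - c) = box_entry 2 S 1 1 r c"
    if "r \<in> {1..2}" "c \<in> {1..2}" for r c
    using same_band_half_turn[OF joint, of 1 1 2] that by simp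
  have stack: "box_entry 2 S 2 1 (3 - r) (3 - c) = box_entry 2 S 1 1 r c"
    if "r \<in> {1..2}" "c \<in> {1..2}" for r c
    using same_stack_half_turn[OF joint, of 1 1 2] that by simp
  have diagonal: "box_entry 2 S 2 2 r c = box_entry 2 S 1 1 r c"
    if "r \<in> {1..2}" "c \<in> {1..2}" for r c
    using diagonal_boxes_equal[OF joint, of 1 1 2 2] that by simp
  have "S r c = S 1 (base_grid r c)" if "r \<in> {1..2^2}" "c \<in> {1..2^2}" for r c
    using that band[of 1 1] band[of 1 2] band[of 2 1] band[of 2 2]
      stack[of 1 1] stack[of 1 2] stack[of 2 1] stack[of 2 2]
      diagonal[of 1 1] diagonal[of 1 2] diagonal[of 2 1] diagonal[of 2 2]
    unfolding set_1_4 by (auto simp: box_entry_def grid_of_rows_def numeral_eq_Suc)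
  with row show ?thesis unfolding relabeling_of_def by blast
qed

theorem mainTheorem7:
  defines "S0 \<equiv> grid_of_rows [[1, 2, 3, 4], [4, 3, 2, 1], [3, 4, 1, 2], [2, 1, 4, 3]]"
  shows "joint_groups_sudoku 2 S0
    \<and> (\<forall>S. joint_groups_sudoku 2 S \<longrightarrow> relabeling_of 2 S S0)
    \<and> (\<forall>S. joint_groups_sudoku 2 S \<longrightarrow> box_cyclic 2 S)"
  unfolding S0_def
  using base_grid_joint_groups joint_groups_2_relabeling joint_groups_2_box_cyclic by blast

end
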